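(* Let $P$ be a fence poset of size $n$. Then $$\Omega(P;t)=\frac{1}{n!}\sum_{\sigma\in S_n} t^{\,bl_P(\sigma)},$$ where the sum ranges over all $n!$ labelings $\sigma$ of $P$.
   Context: For a finite poset $P$, the order polynomial $\Omega(P;t)$ is the unique polynomial in $\mathbb{Q}[t]$ such that for every positive integer $t$, $\Omega(P;t)=\#\{f:P\to\{1,\dots,t\}: f(x)\le f(y)\text{ whenever }x\preceq y\}$. A fence poset of size $n$ is a poset on elements placed at positions $0,1,\dots,n-1$ from left to right whose Hasse diagram is a path: for each $1\le i\le n-1$ exactly one of $z_{i-1}\prec z_i$ or $z_{i-1}\succ z_i$ is imposed as a cover relation, and the order is generated by these relations. $\mathrm{desc}(P)$ is the set of elements that are lower than the element immediately at their left; $\mathrm{asc}(P)$ is the set of elements that are greater than the element immediately at their left, together with the leftmost element. A labeling of $P$ is a bijection $\sigma:P\to\{1,\dots,n\}$; the set of labelings is identified with $S_n$. Given $\sigma$, a block is a nonempty set of consecutive elements of $P$ such that, writing $x$ for its leftmost element (called the root of the block), every other element $y$ of the block satisfies: $\sigma(y)<\sigma(x)$ if $y\in \mathrm{asc}(P)$, and $\sigma(y)>\sigma(x)$ if $y\in\mathrm{desc}(P)$. A block partition of $(P,\sigma)$ is a partition $\{B_1,\dots,B_k\}$ of $P$ into blocks; let $x_i$ be the root of $B_i$. Write $B_i<B_j$ if there are $y\in B_i$, $z\in B_j$ with $y<_P z$. The block partition is valid if for all $i\ne j$, $B_i<B_j$ implies $\sigma(x_i)<\sigma(x_j)$. There is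 exactly one valid block partition of $(P,\sigma)$, and $bl_P(\sigma)$ denotes its number of blocks. *)

theory Defs
  imports "HOL-Library.FuncSet" "HOL-Library.Disjoint_Sets"
    "HOL-Computational_Algebra.Polynomial"
begin

definition poset_less :: "'a rel \<Rightarrow> 'a \<Rightarrow> 'a \<Rightarrow> bool" where
  "poset_less r x y \<longleftrightarrow> (x, y) \<in> r \<and> x \<noteq> y"

(* Maps are extensional, i.e. undefined outside the carrier A, so that each map on A
   is counted exactly once. *)
definition order_preserving_maps :: "'a set \<Rightarrow> 'a rel \<Rightarrow> nat \<Rightarrow> ('a \<Rightarrow> nat) set" where
  "order_preserving_maps A r t =
     {f \<in> A \<rightarrow>\<^sub>E {1..t}. \<forall>x\<in>A. \<forall>y\<in>A. (x, y) \<in> r \<longrightarrow> f x \<le> f y}"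

definition order_polynomial :: "'a set \<Rightarrow> 'a rel \<Rightarrow> rat poly" where
  "order_polynomial A r =
     (THE p. \<forall>t::nat. t > 0 \<longrightarrow>
        poly p (of_nat t) = of_nat (card (order_preserving_maps A r t)))"

(* The elements of a fence of size n are identified with their positions 0, ..., n - 1;
   U i says that position i lies above position i - 1, and otherwise it lies below. *)
definition fence_covers :: "nat \<Rightarrow> (nat \<Rightarrow> bool) \<Rightarrow> nat rel" where
  "fence_covers n U =
     {(i - 1, i) | i. 1 \<le> i \<and> i < n \<and> U i} \<union> {(i, i - 1) | i. 1 \<le> i \<and> i < n \<and> \<not> U i}"

definition fence_poset :: "nat \<Rightarrow> nat rel \<Rightarrow> bool" where
  "fence_poset n r \<longleftrightarrow> (\<exists>U. r = (fence_covers n U)\<^sup>* \<inter> ({..<n} \<times> {..<n}))"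

definition fence_desc :: "nat \<Rightarrow> nat rel \<Rightarrow> nat set" where
  "fence_desc n r = {i. 1 \<le> i \<and> i < n \<and> poset_less r i (i - 1)}"

definition fence_asc :: "nat \<Rightarrow> nat rel \<Rightarrow> nat set" where
  "fence_asc n r = {i. i < n \<and> (i = 0 \<or> poset_less r (i - 1) i)}"

definition labelings :: "nat \<Rightarrow> (nat \<Rightarrow> nat) set" where
  "labelings n = {\<sigma> \<in> {..<n} \<rightarrow>\<^sub>E {1..n}. bij_betw \<sigma> {..<n} {1..n}}"

abbreviation block_root :: "nat set \<Rightarrow> nat" where
  "block_root B \<equiv> Min B"

definition is_block :: "nat \<Rightarrow> nat rel \<Rightarrow> (nat \<Rightarrow> nat) \<Rightarrow> nat set \<Rightarrow> bool" where
  "is_block n r \<sigma> B \<longleftrightarrow>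
     (\<exists>a b. a \<le> b \<and> b < n \<and> B = {a..b}) \<and>
     (\<forall>y\<in>B - {block_root B}.
        (y \<in> fence_asc n r \<longrightarrow> \<sigma> y < \<sigma> (block_root B)) \<and>
        (y \<in> fence_desc n r \<longrightarrow> \<sigma> y > \<sigma> (block_root B)))"

definition block_partition :: "nat \<Rightarrow> nat rel \<Rightarrow> (nat \<Rightarrow> nat) \<Rightarrow> nat set set \<Rightarrow> bool" where
  "block_partition n r \<sigma> Q \<longleftrightarrow> partition_on {..<n} Q \<and> (\<forall>B\<in>Q. is_block n r \<sigma> B)"

definition block_less :: "'a rel \<Rightarrow> 'a set \<Rightarrow> 'a set \<Rightarrow> bool" where
  "block_less r B C \<longleftrightarrow> (\<exists>y\<in>B. \<exists>z\<in>C. poset_less r y z)"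

definition valid_block_partition :: "nat \<Rightarrow> nat rel \<Rightarrow> (nat \<Rightarrow> nat) \<Rightarrow> nat set set \<Rightarrow> bool" where
  "valid_block_partition n r \<sigma> Q \<longleftrightarrow>
     block_partition n r \<sigma> Q \<and>
     (\<forall>B\<in>Q. \<forall>C\<in>Q. B \<noteq> C \<and> block_less r B C \<longrightarrow> \<sigma> (block_root B) < \<sigma> (block_root C))"

definition bl :: "nat \<Rightarrow> nat rel \<Rightarrow> (nat \<Rightarrow> nat) \<Rightarrow> nat" where
  "bl n r \<sigma> = card (THE Q. valid_block_partition n r \<sigma> Q)"

end

theory Submission
  imports Defs "HOL-Combinatorics.Multiset_Permutations"
begin

text \<open>
  The valid block partition of a labeling is forced: reading the fence from left to right, the next
  position either must join the block of the current root or must open a new block, depending on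
  the comparison of its label with that of the root (\<open>scan_partition_valid\<close>,
  \<open>valid_block_partition_unique\<close>). Hence the number of blocks is computed by a scan whose only
  memory is the label of the current root.

  To see that the generating function of this scan is \<open>n!\<close> times the order polynomial, imagine the
  labels as independent uniform points of the unit interval, and let \<open>g(u)\<close> be the expected value
  of \<open>t\<close> to the number of blocks still to come when the current root is at \<open>u\<close>. Putting a step
  upwards in front replaces \<open>g\<close> by \<open>u g(u) + t W(u)\<close>, where \<open>W(u)\<close> is the integral of \<open>g\<close>
  from \<open>u\<close> to \<open>1\<close>. Likewise let \<open>h(k)\<close> be the number of order preserving continuations with
  values in \<open>{1..t}\<close> when the last value is \<open>k\<close>; putting a step upwards in front replaces \<open>h(k)\<close>
  by the sum of \<open>h(j)\<close> over \<open>j \<ge> k\<close>. The two operators are the same one if \<open>h(1), \<dots>, h(t)\<close>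
  are regarded as the coefficients of \<open>g\<close> in the Bernstein basis of degree \<open>t - 1\<close>
  (\<open>partial_sum_bernstein\<close>). By the symmetry of the situation the same holds for steps downwards.

  No probability is needed to make this precise. If \<open>m\<close> positions remain, then the coefficients of
  \<open>g\<close> in the Bernstein basis of degree \<open>m\<close> are, up to the factor \<open>m!\<close>, the generating functions
  of the scan for a root with a prescribed rank among the remaining labels. So \<open>g\<close> is a
  polynomial with two Bernstein expansions, one for each count (\<open>bernstein_sum_eq\<close>). A virtual
  element of label \<open>0\<close> and value \<open>1\<close> below the leftmost position makes the whole fence the rest of
  a scan, and evaluation at \<open>u = 0\<close> gives the claim (\<open>block_weight_eq_chain_extensions\<close>).
\<close>

section \<open>Two recursions along a fence\<close>

text \<open>
  Both sides of the theorem are computed by scanning the fence from left to right. A list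
  \<open>cs\<close> records the directions of the remaining steps, \<open>True\<close> for a step upwards.
  In \<open>chain_extensions cs a b\<close> the last value assigned so far has \<open>a\<close> possible
  values below it and \<open>b\<close> above it, so that there are \<open>a + b + 1\<close> values in all, and the
  count is over the order preserving ways to go on.
\<close>
fun chain_extensions :: "bool list \<Rightarrow> nat \<Rightarrow> nat \<Rightarrow> nat" where
  "chain_extensions [] a b = 1"
| "chain_extensions (c # cs) a b =
     (if c then \<Sum>j\<le>b. chain_extensions cs (a + j) (b - j)
      else \<Sum>j\<le>a. chain_extensions cs (a - j) (b + j))"

text \<open>
  Here the current root has \<open>a\<close> of the unused labels below it and \<open>b\<close> above it, and
  \<open>length cs = a + b\<close> positions are still to be labelled. On a step upwards a smaller label
  joins the current block and uses up one of the \<open>a\<close> labels, whereas a larger one costs a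
  factor \<open>t\<close> and is the root of a new block; \<open>j\<close> is its rank among the \<open>b\<close> larger labels.
\<close>
fun block_weight :: "nat \<Rightarrow> bool list \<Rightarrow> nat \<Rightarrow> nat \<Rightarrow> nat" where
  "block_weight t [] a b = 1"
| "block_weight t (c # cs) a b =
     (if c then a * block_weight t cs (a - 1) b
            + t * (\<Sum>j<b. block_weight t cs (a + j) (b - 1 - j))
      else b * block_weight t cs a (b - 1)
            + t * (\<Sum>j<a. block_weight t cs (a - 1 - j) (b + j)))"

text \<open>
  Turning the fence upside down exchanges below and above; this symmetry reduces every step
  downwards to a step upwards.
\<close>
lemma chain_extensions_flip: "chain_extensions (map Not cs) a b = chain_extensions cs b a"
  by (induction cs arbitrary: a b) auto

lemma block_weight_flip: "block_weight t (map Not cs) a b = block_weight t cs b a"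
  by (induction cs arbitrary: a b) auto

section \<open>Scaled Bernstein polynomials\<close>

lemma smult_sum_right: "smult c (\<Sum>i\<in>I. f i) = (\<Sum>i\<in>I. smult c (f i))"
  by (induction I rule: infinite_finite_induct) (simp_all add: smult_add_right)

text \<open>
  The Bernstein polynomial of index \<open>a\<close> in degree \<open>a + b\<close>, divided by the factorial of that
  degree. With this scaling neither the derivative nor multiplication by \<open>X\<close> or \<open>1 - X\<close>
  involves a binomial coefficient.
\<close>
definition bernstein :: "nat \<Rightarrow> nat \<Rightarrow> rat poly" where
  "bernstein a b = smult (1 / (fact a * fact b)) ([:0, 1:] ^ a * [:1, -1:] ^ b)"

lemma X_times_bernstein: "[:0, 1:] * bernstein a b = smult (of_nat (Suc a)) (bernstein (Suc a) b)"
proof -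
  have "of_nat (Suc a) * (1 / (fact (Suc a) * fact b)) = (1 / (fact a * fact b) :: rat)"
    by (simp add: field_simps del: of_nat_Suc)
  then show ?thesis
    by (simp only: bernstein_def smult_smult power_Suc mult_smult_right mult.assoc)
qed

lemma one_minus_X_times_bernstein:
  "[:1, -1:] * bernstein a b = smult (of_nat (Suc b)) (bernstein a (Suc b))"
proof -
  have "of_nat (Suc b) * (1 / (fact a * fact (Suc b))) = (1 / (fact a * fact b) :: rat)"
    by (simp add: field_simps del: of_nat_Suc)
  then show ?thesis
    by (simp only: bernstein_def smult_smult power_Suc mult_smult_right mult.left_commute)
qed

lemma pderiv_one_minus_X_power:
  "pderiv ([:1, -1:] ^ Suc b) = smult (- of_nat (Suc b)) ([:1, -1 :: rat:] ^ b)"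
  by (simp only: pderiv_power_Suc) (simp add: pderiv_pCons)

lemma pderiv_X_power:
  "pderiv ([:0, 1:] ^ Suc b) = smult (of_nat (Suc b)) ([:0, 1 :: rat:] ^ b)"
  by (simp only: pderiv_power_Suc) (simp add: pderiv_pCons)

lemma pderiv_bernstein_0: "pderiv (bernstein 0 (Suc b)) = - bernstein 0 b"
proof -
  have "1 / (fact 0 * fact (Suc b)) * (- of_nat (Suc b)) = (- (1 / (fact 0 * fact b)) :: rat)"
    by (simp add: field_simps del: of_nat_Suc)
  then show ?thesis
    unfolding bernstein_def pderiv_smult power_0 mult_1_left pderiv_one_minus_X_power smult_smult
    by simp
qed

lemma pderiv_bernstein_Suc:
  "pderiv (bernstein (Suc a) (Suc b)) = bernstein a (Suc b) - bernstein (Suc a) b"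
proof -
  let ?c = "1 / (fact (Suc a) * fact (Suc b)) :: rat"
  have 1: "?c * (- of_nat (Suc b)) = - (1 / (fact (Suc a) * fact b))"
    by (simp add: field_simps del: of_nat_Suc)
  have 2: "?c * of_nat (Suc a) = 1 / (fact a * fact (Suc b))"
    by (simp add: field_simps del: of_nat_Suc)
  show ?thesis
    unfolding bernstein_def pderiv_smult pderiv_mult pderiv_one_minus_X_power pderiv_X_power
      smult_add_right mult_smult_left mult_smult_right smult_smult 1 2
    by (simp add: mult.commute)
qed

lemma poly_bernstein_0: "poly (bernstein a b) 0 = (if a = 0 then 1 / fact b else 0)"
  by (simp add: bernstein_def)

lemma poly_bernstein_1: "poly (bernstein a (Suc b)) 1 = 0"
  by (simp add: bernstein_def)

lemma bernstein_reflect: "pcompose (bernstein a b) [:1, -1:] = bernstein b a"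
proof -
  have power: "pcompose (p ^ k) q = pcompose p q ^ k" for p q :: "rat poly" and k
    by (induction k) (simp_all add: pcompose_mult pcompose_1)
  show ?thesis
    by (simp add: bernstein_def pcompose_smult pcompose_mult power pcompose_pCons mult.commute)
qed

text \<open>
  The Bernstein polynomials of a fixed degree are a partition of unity.
\<close>
lemma sum_bernstein: "smult (fact T) (\<Sum>k\<le>T. bernstein k (T - k)) = 1"
proof -
  have "[:0, 1:] + [:1, -1:] = (1 :: rat poly)"
    by (simp add: one_pCons)
  then have "1 = ([:0, 1:] + [:1, -1:] :: rat poly) ^ T"
    by (simp only: power_one)
  also have "\<dots> = (\<Sum>k\<le>T. of_nat (T choose k) * [:0, 1:] ^ k * [:1, -1:] ^ (T - k))"
    by (rule binomial_ring)
  also have "\<dots> = (\<Sum>k\<le>T. smult (fact T) (bernstein k (T - k)))"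
  proof (rule sum.cong)
    fix k assume "k \<in> {..T}"
    then have "of_nat (T choose k) = (fact T / (fact k * fact (T - k)) :: rat)"
      by (simp add: binomial_fact)
    then show "of_nat (T choose k) * [:0, 1:] ^ k * [:1, -1:] ^ (T - k)
        = smult (fact T) (bernstein k (T - k))"
      by (simp add: bernstein_def of_nat_poly mult.assoc)
  qed simp
  finally show ?thesis by (simp add: smult_sum_right)
qed

text \<open>
  The relation says that \<open>w(u)\<close> is the integral of \<open>g\<close> from \<open>u\<close> to \<open>1\<close>. What matters is
  that \<open>w\<close> is determined by the polynomial \<open>g\<close>, in whatever degree \<open>g\<close> is expanded.
\<close>
definition tail_integral :: "rat poly \<Rightarrow> rat poly \<Rightarrow> bool" where
  "tail_integral g w \<longleftrightarrow> pderiv w = - g \<and> poly w 1 = 0"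

lemma tail_integral_unique:
  assumes "tail_integral g w" "tail_integral g w'"
  shows "w = w'"
proof -
  have "pderiv (w - w') = 0" "poly (w - w') 1 = 0"
    using assms by (auto simp: tail_integral_def pderiv_diff)
  then obtain h where h: "w - w' = [:h:]"
    using pderiv_iszero by blast
  then have "w - w' = 0"
    using \<open>poly (w - w') 1 = 0\<close> unfolding h by simp
  then show ?thesis by simp
qed

lemma tail_integral_combination:
  assumes "\<And>i. i \<in> I \<Longrightarrow> tail_integral (g i) (w i)"
  shows "tail_integral (\<Sum>i\<in>I. smult (c i) (g i)) (\<Sum>i\<in>I. smult (c i) (w i))"
proof -
  have "(\<Sum>i\<in>I. smult (c i) (pderiv (w i))) = - (\<Sum>i\<in>I. smult (c i) (g i))"
    using assms by (simp add: tail_integral_def sum_negf)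
  moreover have "(\<Sum>i\<in>I. c i * poly (w i) 1) = 0"
    using assms by (simp add: tail_integral_def)
  ultimately show ?thesis
    using higher_pderiv_sum[of 1 "\<lambda>i. smult (c i) (w i)" I]
    by (simp add: tail_integral_def pderiv_smult poly_sum)
qed

text \<open>
  The derivatives of the summands telescope, and each summand contains a factor \<open>1 - X\<close>.
\<close>
lemma tail_integral_bernstein:
  "tail_integral (bernstein a b) (\<Sum>i\<le>a. bernstein i (Suc (a + b) - i))"
proof (induction a arbitrary: b)
  case 0
  show ?case by (simp add: tail_integral_def pderiv_bernstein_0 poly_bernstein_1)
next
  case (Suc a)
  show ?case
    using Suc[of "Suc b"]
    by (simp add: tail_integral_def pderiv_add pderiv_bernstein_Suc poly_bernstein_1 Suc_diff_le)
qed

text \<open>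
  This is where the weight \<open>t\<close> comes from. Let \<open>t = a + b + 1\<close> be the number of values of
  an order preserving map. The left-hand side collects the values from which a step upwards can
  reach the one that has \<open>a\<close> values below it. The right-hand side is the
  effect of one step of the scan at a root of height \<open>X\<close>: the next label is below the root and
  joins its block with probability \<open>X\<close>, or else it is a new root above, averaged by the integral
  and weighted by \<open>t\<close>.
\<close>
lemma partial_sum_bernstein:
  "(\<Sum>i\<le>a. bernstein i (a + b - i)) =
     [:0, 1:] * bernstein a b
     + smult (of_nat (Suc (a + b))) (\<Sum>i\<le>a. bernstein i (Suc (a + b) - i))"
proof (induction a arbitrary: b)
  case 0
  have "bernstein 0 b = [:0, 1:] * bernstein 0 b + [:1, -1:] * bernstein 0 b"
    by (simp flip: distrib_right)
  then show ?case
    by (simp only: one_minus_X_times_bernstein) simp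
next
  case (Suc a)
  have "bernstein (Suc a) b = [:0, 1:] * bernstein (Suc a) b + [:1, -1:] * bernstein (Suc a) b"
    by (simp flip: distrib_right)
  moreover define p where "p = [:0, 1:] * bernstein (Suc a) b"
  ultimately have split: "bernstein (Suc a) b = p + smult (of_nat (Suc b)) (bernstein (Suc a) (Suc b))"
    by (simp only: one_minus_X_times_bernstein)
  have "(\<Sum>i\<le>Suc a. bernstein i (Suc a + b - i)) =
      (\<Sum>i\<le>a. bernstein i (a + Suc b - i)) + bernstein (Suc a) b"
    by simp
  also have "\<dots> = smult (of_nat (Suc a)) (bernstein (Suc a) (Suc b))
      + smult (of_nat (Suc (a + Suc b))) (\<Sum>i\<le>a. bernstein i (Suc (a + Suc b) - i))
      + bernstein (Suc a) b"
    unfolding Suc X_times_bernstein ..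
  also have "\<dots> = p
      + smult (of_nat (Suc (Suc a + b))) (\<Sum>i\<le>Suc a. bernstein i (Suc (Suc a + b) - i))"
  proof -
    have shift: "Suc (a + Suc b) = Suc (Suc a + b)" "Suc (Suc a + b) - Suc a = Suc b"
      by simp_all
    have "smult (of_nat (Suc (Suc a + b))) q
        = smult (of_nat (Suc a)) q + smult (of_nat (Suc b)) q" for q :: "rat poly"
      by (simp only: smult_add_left[symmetric] of_nat_add[symmetric]) simp
    from this[of "bernstein (Suc a) (Suc b)"] show ?thesis
      unfolding split shift sum.atMost_Suc smult_add_right by (simp only: ac_simps)
  qed
  finally show ?case unfolding p_def .
qed

section \<open>Both recursions as one operator on polynomials\<close>

lemma sum_triangle_swap:
  fixes f :: "nat \<Rightarrow> nat \<Rightarrow> 'a :: comm_monoid_add"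
  shows "(\<Sum>k\<le>m. \<Sum>j\<le>m - k. f k (k + j)) = (\<Sum>c\<le>m. \<Sum>k\<le>c. f k c)"
  unfolding sum.Sigma[OF finite_atMost ballI[OF finite_atMost]]
  by (rule sum.reindex_bij_witness
      [where i = "\<lambda>(c, k). (k, c - k)" and j = "\<lambda>(k, j). (k + j, k)"]) auto

text \<open>
  The polynomial whose Bernstein coefficients in degree \<open>m\<close> are, up to the scaling, the values
  of \<open>F\<close> on the pairs with sum \<open>m\<close>.
\<close>
definition bernstein_sum :: "nat \<Rightarrow> (nat \<Rightarrow> nat \<Rightarrow> nat) \<Rightarrow> rat poly" where
  "bernstein_sum m F = (\<Sum>k\<le>m. smult (of_nat (F k (m - k))) (bernstein k (m - k)))"

lemma bernstein_sum_flip: "bernstein_sum m (\<lambda>a b. F b a) = pcompose (bernstein_sum m F) [:1, -1:]"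
proof -
  have "bernstein_sum m (\<lambda>a b. F b a)
      = (\<Sum>k\<le>m. smult (of_nat (F k (m - k))) (bernstein (m - k) k))"
    unfolding bernstein_sum_def
    by (rule sum.reindex_bij_witness[where i = "\<lambda>k. m - k" and j = "\<lambda>k. m - k"]) auto
  then show ?thesis
    by (simp add: bernstein_sum_def pcompose_sum pcompose_smult bernstein_reflect)
qed

lemma bernstein_sum_triangle:
  fixes q :: "nat \<Rightarrow> rat poly"
  shows "(\<Sum>k\<le>m. smult (of_nat (\<Sum>j\<le>m - k. F (k + j) (m - k - j))) (q k)) =
   (\<Sum>c\<le>m. smult (of_nat (F c (m - c))) (\<Sum>k\<le>c. q k))"
  using sum_triangle_swap[where f = "\<lambda>k c. smult (of_nat (F c (m - c))) (q k)" and m = m]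
  by (simp add: smult_sum smult_sum_right)

lemma tail_integral_bernstein_sum:
  "tail_integral (bernstein_sum m F)
     (\<Sum>c\<le>m. smult (of_nat (F c (m - c))) (\<Sum>k\<le>c. bernstein k (Suc m - k)))"
  unfolding bernstein_sum_def
proof (rule tail_integral_combination)
  fix i assume "i \<in> {..m}"
  then show "tail_integral (bernstein i (m - i)) (\<Sum>k\<le>i. bernstein k (Suc m - k))"
    using tail_integral_bernstein[of i "m - i"] by simp
qed

text \<open>
  If \<open>g\<close> is the polynomial before the step and \<open>W\<close> its tail integral, then the polynomial after
  the step is \<open>X g + t W\<close>, where \<open>t\<close> is the number of values.
\<close>
lemma bernstein_sum_chain_extensions_up:
  "bernstein_sum T (chain_extensions (True # cs)) =
     [:0, 1:] * bernstein_sum T (chain_extensions cs) + smult (of_nat (Suc T))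
       (\<Sum>c\<le>T. smult (of_nat (chain_extensions cs c (T - c))) (\<Sum>k\<le>c. bernstein k (Suc T - k)))"
proof -
  have "bernstein_sum T (chain_extensions (True # cs)) =
      (\<Sum>c\<le>T. smult (of_nat (chain_extensions cs c (T - c))) (\<Sum>k\<le>c. bernstein k (T - k)))"
    unfolding bernstein_sum_triangle[symmetric] by (simp add: bernstein_sum_def)
  also have "\<dots> = (\<Sum>c\<le>T. smult (of_nat (chain_extensions cs c (T - c)))
      ([:0, 1:] * bernstein c (T - c)
       + smult (of_nat (Suc T)) (\<Sum>k\<le>c. bernstein k (Suc T - k))))"
  proof (rule sum.cong)
    fix c assume "c \<in> {..T}"
    then have "c + (T - c) = T"
      by simp
    then show "smult (of_nat (chain_extensions cs c (T - c))) (\<Sum>k\<le>c. bernstein k (T - k)) =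
        smult (of_nat (chain_extensions cs c (T - c)))
          ([:0, 1:] * bernstein c (T - c)
           + smult (of_nat (Suc T)) (\<Sum>k\<le>c. bernstein k (Suc T - k)))"
      using partial_sum_bernstein[of c "T - c"] by metis
  qed simp
  finally show ?thesis
    by (simp add: bernstein_sum_def smult_add_right sum.distrib sum_distrib_left smult_sum_right
        mult.commute del: mult_pCons_left mult_pCons_right)
qed

text \<open>
  The same operation \<open>X g + t W\<close>, now with a free parameter \<open>t\<close> and with a degree that grows by
  one at each step, since one more label is accounted for.
\<close>
lemma bernstein_sum_block_weight_up:
  "bernstein_sum (Suc m) (block_weight t (True # cs)) =
     [:0, 1:] * bernstein_sum m (block_weight t cs) + smult (of_nat t)
       (\<Sum>c\<le>m. smult (of_nat (block_weight t cs c (m - c))) (\<Sum>k\<le>c. bernstein k (Suc m - k)))"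
proof -
  let ?G = "block_weight t cs"
  have stay: "(\<Sum>k\<le>Suc m. smult (of_nat (k * ?G (k - 1) (Suc m - k))) (bernstein k (Suc m - k)))
      = [:0, 1:] * bernstein_sum m ?G"
    unfolding sum.atMost_Suc_shift bernstein_sum_def sum_distrib_left mult_smult_right
      X_times_bernstein by (simp add: algebra_simps)
  have "(\<Sum>k\<le>Suc m. smult (of_nat (\<Sum>j<Suc m - k. ?G (k + j) (Suc m - k - 1 - j)))
        (bernstein k (Suc m - k)))
      = (\<Sum>k\<le>m. smult (of_nat (\<Sum>j\<le>m - k. ?G (k + j) (m - k - j))) (bernstein k (Suc m - k)))"
    unfolding sum.atMost_Suc by (simp add: Suc_diff_le lessThan_Suc_atMost)
  then have leave: "(\<Sum>k\<le>Suc m. smult (of_nat (\<Sum>j<Suc m - k. ?G (k + j) (Suc m - k - 1 - j)))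
        (bernstein k (Suc m - k)))
      = (\<Sum>c\<le>m. smult (of_nat (?G c (m - c))) (\<Sum>k\<le>c. bernstein k (Suc m - k)))"
    using bernstein_sum_triangle[where F = ?G and m = m and q = "\<lambda>k. bernstein k (Suc m - k)"]
    by (rule trans)
  have "bernstein_sum (Suc m) (block_weight t (True # cs)) =
      (\<Sum>k\<le>Suc m. smult (of_nat (k * ?G (k - 1) (Suc m - k))) (bernstein k (Suc m - k))
        + smult (of_nat t) (smult (of_nat (\<Sum>j<Suc m - k. ?G (k + j) (Suc m - k - 1 - j)))
            (bernstein k (Suc m - k))))"
    unfolding bernstein_sum_def
    by (simp only: block_weight.simps if_True of_nat_add of_nat_mult smult_add_left smult_smult)
  then show ?thesis
    by (simp only: sum.distrib smult_sum_right[symmetric] stay leave)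
qed

text \<open>
  Induction over the fence: the two polynomials have different degrees of expansion, but they agree
  for the empty fence, and each step upwards applies the operator \<open>g \<mapsto> X g + t W\<close> to both.
  Since the operator depends on the polynomial only, equality is preserved. Steps downwards follow by
  the substitution of \<open>1 - X\<close> for \<open>X\<close>.
\<close>
lemma bernstein_sum_eq:
  "smult (fact T) (bernstein_sum T (chain_extensions cs)) =
     bernstein_sum (length cs) (block_weight (Suc T) cs)"
proof (induction "length cs" arbitrary: cs)
  case 0
  have "bernstein 0 0 = 1"
    by (simp add: bernstein_def)
  with 0 show ?case
    using sum_bernstein[of T] by (simp add: bernstein_sum_def)
next
  case (Suc m)
  have up: "smult (fact T) (bernstein_sum T (chain_extensions (True # cs))) =
      bernstein_sum (Suc m) (block_weight (Suc T) (True # cs))" if "m = length cs" for cs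
  proof -
    let ?W = "\<lambda>m F. \<Sum>c\<le>m. smult (of_nat (F c (m - c))) (\<Sum>k\<le>c. bernstein k (Suc m - k))"
    let ?H = "chain_extensions cs" and ?G = "block_weight (Suc T) cs"
    have IH: "smult (fact T) (bernstein_sum T ?H) = bernstein_sum m ?G"
      using Suc(1)[OF that] unfolding that .
    have "tail_integral (smult (fact T) (bernstein_sum T ?H)) (smult (fact T) (?W T ?H))"
      using tail_integral_bernstein_sum[of T ?H]
      by (simp add: tail_integral_def pderiv_smult del: sum.atMost_Suc)
    then have W: "smult (fact T) (?W T ?H) = ?W m ?G"
      unfolding IH using tail_integral_bernstein_sum by (rule tail_integral_unique)
    have "smult d (x * p + smult e w) = x * smult d p + smult e (smult d w)"
      for d e and x p w :: "rat poly"
      by (simp add: smult_add_right mult.commute)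
    then have "smult (fact T) (bernstein_sum T (chain_extensions (True # cs))) =
        [:0, 1:] * smult (fact T) (bernstein_sum T ?H)
        + smult (of_nat (Suc T)) (smult (fact T) (?W T ?H))"
      unfolding bernstein_sum_chain_extensions_up .
    also have "\<dots> = bernstein_sum (Suc m) (block_weight (Suc T) (True # cs))"
      by (simp only: IH W bernstein_sum_block_weight_up)
    finally show ?thesis .
  qed
  obtain c cs' where cs: "cs = c # cs'" and m: "m = length cs'"
    using Suc(2) by (cases cs) auto
  show ?case
  proof (cases c)
    case True
    then show ?thesis using up[OF m] unfolding cs m by simp
  next
    case False
    let ?ds = "True # map Not cs'"
    have *: "cs = map Not ?ds" using False cs by (simp add: comp_def)
    have H: "chain_extensions cs = (\<lambda>a b. chain_extensions ?ds b a)"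
      unfolding * by (intro ext chain_extensions_flip)
    have G: "block_weight (Suc T) cs = (\<lambda>a b. block_weight (Suc T) ?ds b a)"
      unfolding * by (intro ext block_weight_flip)
    have "smult (fact T) (bernstein_sum T (chain_extensions cs)) =
        pcompose (smult (fact T) (bernstein_sum T (chain_extensions ?ds))) [:1, -1:]"
      unfolding H bernstein_sum_flip[of T "chain_extensions ?ds"] pcompose_smult ..
    also have "\<dots> = pcompose (bernstein_sum (Suc m) (block_weight (Suc T) ?ds)) [:1, -1:]"
      by (subst up) (simp_all add: m)
    also have "\<dots> = bernstein_sum (Suc m) (block_weight (Suc T) cs)"
      unfolding G by (rule bernstein_sum_flip[symmetric])
    finally show ?thesis
      unfolding Suc(2) .
  qed
qed

lemma poly_bernstein_sum_0: "poly (bernstein_sum m F) 0 = of_nat (F 0 m) / fact m"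
proof -
  have "poly (bernstein_sum m F) 0 =
      (\<Sum>k\<le>m. if k = 0 then of_nat (F k (m - k)) / fact (m - k) else 0)"
    unfolding bernstein_sum_def poly_sum by (rule sum.cong) (simp_all add: poly_bernstein_0)
  then show ?thesis by simp
qed

text \<open>
  At \<open>0\<close> all Bernstein polynomials except the one of index \<open>0\<close> vanish. Probabilistically, a
  root of height \<open>0\<close> lies below every label.
\<close>
lemma block_weight_eq_chain_extensions:
  "block_weight (Suc T) cs 0 (length cs) = fact (length cs) * chain_extensions cs 0 T"
proof -
  have "(of_nat (chain_extensions cs 0 T) :: rat)
      = of_nat (block_weight (Suc T) cs 0 (length cs)) / fact (length cs)"
    using arg_cong[OF bernstein_sum_eq[of T cs], of "\<lambda>p. poly p 0"]
    by (simp add: poly_bernstein_sum_0)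
  then have "(of_nat (block_weight (Suc T) cs 0 (length cs)) :: rat)
      = of_nat (fact (length cs) * chain_extensions cs 0 T)"
    by (simp add: field_simps)
  then show ?thesis by (simp only: of_nat_eq_iff)
qed

section \<open>Counting order preserving sequences and labelings\<close>

fun follows :: "bool list \<Rightarrow> nat \<Rightarrow> nat list \<Rightarrow> bool" where
  "follows [] v xs \<longleftrightarrow> xs = []"
| "follows (c # cs) v [] \<longleftrightarrow> False"
| "follows (c # cs) v (x # xs) \<longleftrightarrow> (if c then v \<le> x else x \<le> v) \<and> follows cs x xs"

lemma follows_imp_length: "follows cs v xs \<Longrightarrow> length xs = length cs"
  by (induction cs v xs rule: follows.induct) auto

lemma card_follows:
  assumes "v \<in> {1..t}"
  shows "card {xs. set xs \<subseteq> {1..t} \<and> follows cs v xs} = chain_extensions cs (v - 1) (t - v)"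
  using assms
proof (induction cs arbitrary: v)
  case Nil
  have "{xs. set xs \<subseteq> {1..t} \<and> follows [] v xs} = {[]}"
    by auto
  then show ?case by simp
next
  case (Cons c cs)
  let ?R = "\<lambda>v. {xs. set xs \<subseteq> {1..t} \<and> follows cs v xs}"
  let ?A = "if c then {v..t} else {1..v}"
  have fin: "finite (?R x)" for x
    by (rule finite_subset[OF _ finite_lists_length_eq[of "{1..t}" "length cs"]])
      (auto dest: follows_imp_length)
  have "{xs. set xs \<subseteq> {1..t} \<and> follows (c # cs) v xs} = (\<lambda>(x, xs). x # xs) ` (SIGMA x:?A. ?R x)"
    (is "?L = ?M")
  proof (intro set_eqI iffI)
    fix ys assume "ys \<in> ?L"
    then show "ys \<in> ?M"
      using Cons.prems by (cases ys) (auto simp: image_iff subset_iff split: if_splits)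
  next
    fix ys assume "ys \<in> ?M"
    then show "ys \<in> ?L"
      using Cons.prems by (auto simp: subset_iff split: if_splits)
  qed
  then have "card ?L = card (SIGMA x:?A. ?R x)"
    by (simp add: card_image inj_on_def)
  also have "\<dots> = (\<Sum>x\<in>?A. card (?R x))"
    using fin by (intro card_SigmaI) auto
  also have "\<dots> = (\<Sum>x\<in>?A. chain_extensions cs (x - 1) (t - x))"
    using Cons.prems by (intro sum.cong refl Cons.IH) (auto split: if_splits)
  also have "\<dots> = chain_extensions (c # cs) (v - 1) (t - v)"
  proof (cases c)
    case True
    have "(\<Sum>x\<in>{v..t}. chain_extensions cs (x - 1) (t - x)) =
        (\<Sum>j\<le>t - v. chain_extensions cs (v - 1 + j) (t - v - j))"
      using Cons.prems
      by (intro sum.reindex_bij_witness[where i = "\<lambda>j. v + j" and j = "\<lambda>x. x - v"]) auto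
    with True show ?thesis by simp
  next
    case False
    have "(\<Sum>x\<in>{1..v}. chain_extensions cs (x - 1) (t - x)) =
        (\<Sum>j\<le>v - 1. chain_extensions cs (v - 1 - j) (t - v + j))"
      using Cons.prems
      by (intro sum.reindex_bij_witness[where i = "\<lambda>j. v - j" and j = "\<lambda>x. v - x"])
        (auto simp: algebra_simps)
    with False show ?thesis by simp
  qed
  finally show ?case .
qed

text \<open>
  The scan that forms the blocks: \<open>v\<close> is the label of the current root, and the entry \<open>x\<close>
  opens a new block exactly if its comparison with \<open>v\<close> forbids it to join.
\<close>
fun new_blocks :: "bool list \<Rightarrow> nat \<Rightarrow> nat list \<Rightarrow> nat" where
  "new_blocks (c # cs) v (x # xs) =
     (if (if c then v < x else x < v) then Suc (new_blocks cs x xs) else new_blocks cs v xs)"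
| "new_blocks _ v _ = 0"

text \<open>
  The elements of a finite linear order have the ranks \<open>0, 1, 2, \<dots>\<close>, each once.
\<close>
lemma sum_by_rank:
  fixes T :: "'a :: linorder set" and F :: "nat \<Rightarrow> nat \<Rightarrow> 'b :: comm_monoid_add"
  assumes "finite T"
  shows "(\<Sum>x\<in>T. F (card {s \<in> T. s < x}) (card {s \<in> T. x < s}))
      = (\<Sum>j<card T. F j (card T - 1 - j))"
proof -
  have above: "card {s \<in> T. x < s} = card T - 1 - card {s \<in> T. s < x}" if "x \<in> T" for x
  proof -
    have "T = insert x ({s \<in> T. s < x} \<union> {s \<in> T. x < s})"
      using that by auto
    then have "card T = Suc (card ({s \<in> T. s < x} \<union> {s \<in> T. x < s}))"
      using assms by (metis (no_types, lifting) Un_iff card_insert_disjoint finite_insert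
          less_irrefl mem_Collect_eq)
    also have "card ({s \<in> T. s < x} \<union> {s \<in> T. x < s}) = card {s \<in> T. s < x} + card {s \<in> T. x < s}"
      using assms by (intro card_Un_disjoint) auto
    finally show ?thesis by simp
  qed
  have rank: "(\<Sum>x\<in>T. H (card {s \<in> T. s < x})) = (\<Sum>j<card T. H j)" for H :: "nat \<Rightarrow> 'b"
    using assms
  proof (induction T rule: finite_linorder_max_induct)
    case (insert m T)
    have "{s \<in> insert m T. s < m} = T" "m \<notin> T"
      using insert.hyps by auto
    moreover have "{s \<in> insert m T. s < x} = {s \<in> T. s < x}" if "x \<in> T" for x
      using insert.hyps that by auto
    ultimately show ?case
      using insert by (simp add: add.commute cong: sum.cong)
  qed simp
  have "(\<Sum>x\<in>T. F (card {s \<in> T. s < x}) (card {s \<in> T. x < s}))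
      = (\<Sum>x\<in>T. F (card {s \<in> T. s < x}) (card T - 1 - card {s \<in> T. s < x}))"
    by (intro sum.cong refl) (simp add: above)
  then show ?thesis
    using rank[of "\<lambda>i. F i (card T - 1 - i)"] by simp
qed

text \<open>
  The recursion for \<open>block_weight\<close> arises by conditioning on the first label \<open>x\<close>; after it,
  only the ranks of the current root among the unused labels matter.
\<close>
lemma sum_new_blocks:
  assumes "finite S" "card S = length cs" "v \<notin> S"
  shows "(\<Sum>xs\<in>permutations_of_set S. t ^ new_blocks cs v xs)
      = block_weight t cs (card {s \<in> S. s < v}) (card {s \<in> S. v < s})"
  using assms
proof (induction cs arbitrary: S v)
  case Nil
  then show ?case by simp
next
  case (Cons c cs)
  let ?below = "{s \<in> S. s < v}" and ?above = "{s \<in> S. v < s}"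
  let ?G = "block_weight t cs"
  let ?stay = "\<lambda>x. ?G (card {s \<in> S - {x}. s < v}) (card {s \<in> S - {x}. v < s})"
  let ?leave = "\<lambda>x. t * ?G (card {s \<in> S - {x}. s < x}) (card {s \<in> S - {x}. x < s})"
  have compare: "x < v \<or> v < x" if "x \<in> S" for x
    using that Cons.prems by (metis linorder_neqE_nat)
  have "S \<noteq> {}"
    using Cons.prems by auto
  then have "permutations_of_set S = (\<lambda>(x, xs). x # xs) ` (SIGMA x:S. permutations_of_set (S - {x}))"
    by (subst permutations_of_set_nonempty) auto
  then have "(\<Sum>xs\<in>permutations_of_set S. t ^ new_blocks (c # cs) v xs)
      = (\<Sum>(x, xs)\<in>(SIGMA x:S. permutations_of_set (S - {x})). t ^ new_blocks (c # cs) v (x # xs))"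
    by (simp add: sum.reindex inj_on_def case_prod_unfold)
  also have "\<dots> = (\<Sum>x\<in>S. \<Sum>xs\<in>permutations_of_set (S - {x}). t ^ new_blocks (c # cs) v (x # xs))"
    using Cons.prems by (subst sum.Sigma) auto
  also have "\<dots> = (\<Sum>x\<in>S. if (if c then v < x else x < v) then ?leave x else ?stay x)"
  proof (rule sum.cong)
    fix x assume "x \<in> S"
    then have IH: "(\<Sum>xs\<in>permutations_of_set (S - {x}). t ^ new_blocks cs u xs)
        = ?G (card {s \<in> S - {x}. s < u}) (card {s \<in> S - {x}. u < s})" if "u \<notin> S - {x}" for u
      using Cons.prems that by (intro Cons.IH) auto
    show "(\<Sum>xs\<in>permutations_of_set (S - {x}). t ^ new_blocks (c # cs) v (x # xs))
        = (if (if c then v < x else x < v) then ?leave x else ?stay x)"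
      using IH[of x] IH[of v] Cons.prems by (simp add: sum_distrib_left[symmetric])
  qed simp
  also have "\<dots> = (\<Sum>x\<in>?below. if c then ?stay x else ?leave x)
      + (\<Sum>x\<in>?above. if c then ?leave x else ?stay x)"
  proof -
    have "?below \<union> ?above = S"
      using compare by auto
    moreover have "sum h (?below \<union> ?above) = sum h ?below + sum h ?above" for h :: "nat \<Rightarrow> nat"
      using Cons.prems by (intro sum.union_disjoint) auto
    ultimately have "sum h S = sum h ?below + sum h ?above" for h :: "nat \<Rightarrow> nat"
      by metis
    moreover have "\<not> v < x" if "x < v" for x
      using that by simp
    ultimately show ?thesis
      by (auto intro!: arg_cong2[of _ _ _ _ "(+)"] sum.cong)
  qed
  also have "\<dots> = block_weight t (c # cs) (card ?below) (card ?above)"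
  proof (cases c)
    case True
    have stay: "?stay x = ?G (card ?below - 1) (card ?above)" if "x \<in> ?below" for x
    proof -
      have "{s \<in> S - {x}. s < v} = ?below - {x}" "{s \<in> S - {x}. v < s} = ?above"
        using that by auto
      then show ?thesis
        using that Cons.prems by simp
    qed
    have leave: "?leave x = t * ?G (card ?below + card {s \<in> ?above. s < x}) (card {s \<in> ?above. x < s})"
      if "x \<in> ?above" for x
    proof -
      have "{s \<in> S - {x}. s < x} = ?below \<union> {s \<in> ?above. s < x}"
        "{s \<in> S - {x}. x < s} = {s \<in> ?above. x < s}"
        using that compare by auto
      moreover have "card (?below \<union> {s \<in> ?above. s < x}) = card ?below + card {s \<in> ?above. s < x}"
        using Cons.prems by (intro card_Un_disjoint) auto
      ultimately show ?thesis by simp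
    qed
    have "(\<Sum>x\<in>?below. ?stay x) = card ?below * ?G (card ?below - 1) (card ?above)"
      by (subst sum.cong[OF refl stay]) simp_all
    moreover have "(\<Sum>x\<in>?above. ?leave x) =
        (\<Sum>j<card ?above. t * ?G (card ?below + j) (card ?above - 1 - j))"
      using Cons.prems sum_by_rank[of ?above "\<lambda>i j. t * ?G (card ?below + i) j"]
      by (subst sum.cong[OF refl leave]) simp_all
    ultimately show ?thesis
      using True by (simp only: block_weight.simps if_True sum_distrib_left)
  next
    case False
    have stay: "?stay x = ?G (card ?below) (card ?above - 1)" if "x \<in> ?above" for x
    proof -
      have "{s \<in> S - {x}. v < s} = ?above - {x}" "{s \<in> S - {x}. s < v} = ?below"
        using that by auto
      then show ?thesis
        using that Cons.prems by simp
    qed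
    have leave: "?leave x = t * ?G (card {s \<in> ?below. s < x}) (card ?above + card {s \<in> ?below. x < s})"
      if "x \<in> ?below" for x
    proof -
      have "{s \<in> S - {x}. x < s} = ?above \<union> {s \<in> ?below. x < s}"
        "{s \<in> S - {x}. s < x} = {s \<in> ?below. s < x}"
        using that compare by auto
      moreover have "card (?above \<union> {s \<in> ?below. x < s}) = card ?above + card {s \<in> ?below. x < s}"
        using Cons.prems by (intro card_Un_disjoint) auto
      ultimately show ?thesis by simp
    qed
    have "(\<Sum>x\<in>?above. ?stay x) = card ?above * ?G (card ?below) (card ?above - 1)"
      by (subst sum.cong[OF refl stay]) simp_all
    moreover have "(\<Sum>x\<in>?below. ?leave x) =
        (\<Sum>j<card ?below. t * ?G j (card ?above + (card ?below - 1 - j)))"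
      using Cons.prems sum_by_rank[of ?below "\<lambda>i j. t * ?G i (card ?above + j)"]
      by (subst sum.cong[OF refl leave]) simp_all
    moreover have "\<dots> = (\<Sum>j<card ?below. t * ?G (card ?below - 1 - j) (card ?above + j))"
      by (rule sum.reindex_bij_witness[where i = "\<lambda>j. card ?below - 1 - j"
            and j = "\<lambda>j. card ?below - 1 - j"]) auto
    ultimately show ?thesis
      using False by (simp only: block_weight.simps if_False sum_distrib_left add.commute)
  qed
  finally show ?case .
qed

section \<open>Fence orders\<close>

definition fence_order :: "nat \<Rightarrow> (nat \<Rightarrow> bool) \<Rightarrow> nat rel" where
  "fence_order n U = (fence_covers n U)\<^sup>* \<inter> ({..<n} \<times> {..<n})"

text \<open>
  By transitivity, monotonicity along a fence is a condition on adjacent positions only; this is used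
  for order preserving maps as well as for the labels of the block roots.
\<close>
definition fence_monotone :: "nat \<Rightarrow> (nat \<Rightarrow> bool) \<Rightarrow> (nat \<Rightarrow> nat) \<Rightarrow> bool" where
  "fence_monotone n U f \<longleftrightarrow>
     (\<forall>i. Suc i < n \<longrightarrow> (if U (Suc i) then f i \<le> f (Suc i) else f (Suc i) \<le> f i))"

lemma fence_covers_Suc:
  "fence_covers n U = {(i, Suc i) | i. Suc i < n \<and> U (Suc i)} \<union> {(Suc i, i) | i. Suc i < n \<and> \<not> U (Suc i)}"
proof -
  have "{(i - 1, i) | i. 1 \<le> i \<and> i < n \<and> U i} = {(i, Suc i) | i. Suc i < n \<and> U (Suc i)}"
    by (force simp: Suc_le_eq gr0_conv_Suc)
  moreover have "{(i, i - 1) | i. 1 \<le> i \<and> i < n \<and> \<not> U i} = {(Suc i, i) | i. Suc i < n \<and> \<not> U (Suc i)}"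
    by (force simp: Suc_le_eq gr0_conv_Suc)
  ultimately show ?thesis
    unfolding fence_covers_def by simp
qed

lemma fence_monotone_order:
  assumes "fence_monotone n U f" "(x, y) \<in> fence_order n U"
  shows "f x \<le> f y"
proof -
  have "(x, y) \<in> (fence_covers n U)\<^sup>*"
    using assms by (simp add: fence_order_def)
  then show ?thesis
  proof (induction rule: rtrancl_induct)
    case (step y z)
    then have "f y \<le> f z"
      using assms(1) by (auto simp: fence_covers_Suc fence_monotone_def split: if_splits)
    with step show ?case by simp
  qed simp
qed

text \<open>
  That the opposite relation fails needs an argument because the order is a transitive closure. A
  function that jumps between \<open>i\<close> and \<open>Suc i\<close> and is constant on either side is monotone
  along the fence and separates the two positions.
\<close>
lemma fence_order_step:
  assumes "Suc i < n"
  shows "(i, Suc i) \<in> fence_order n U \<longleftrightarrow> U (Suc i)"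
    and "(Suc i, i) \<in> fence_order n U \<longleftrightarrow> \<not> U (Suc i)"
proof -
  have *: "(i, Suc i) \<in> fence_order n U" if "U (Suc i)"
    using assms that by (auto simp: fence_order_def fence_covers_Suc)
  have **: "(Suc i, i) \<in> fence_order n U" if "\<not> U (Suc i)"
    using assms that by (auto simp: fence_order_def fence_covers_Suc)
  have "(i, Suc i) \<notin> fence_order n U" if "\<not> U (Suc i)"
  proof
    assume "(i, Suc i) \<in> fence_order n U"
    moreover have "fence_monotone n U (\<lambda>j. if j \<le> i then 1 else 0)"
      unfolding fence_monotone_def
    proof (intro allI impI)
      fix j
      have "j \<le> i \<longleftrightarrow> Suc j \<le> i" if "j \<noteq> i"
        using that by auto
      then show "if U (Suc j) then (if j \<le> i then 1 else 0) \<le> (if Suc j \<le> i then 1 else 0 :: nat)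
          else (if Suc j \<le> i then 1 else 0) \<le> (if j \<le> i then 1 else 0 :: nat)"
        using \<open>\<not> U (Suc i)\<close> by (cases "j = i") auto
    qed
    ultimately show False
      using fence_monotone_order by fastforce
  qed
  moreover have "(Suc i, i) \<notin> fence_order n U" if "U (Suc i)"
  proof
    assume "(Suc i, i) \<in> fence_order n U"
    moreover have "fence_monotone n U (\<lambda>j. if j \<le> i then 0 else 1)"
      unfolding fence_monotone_def
    proof (intro allI impI)
      fix j
      have "j \<le> i \<longleftrightarrow> Suc j \<le> i" if "j \<noteq> i"
        using that by auto
      then show "if U (Suc j) then (if j \<le> i then 0 else 1) \<le> (if Suc j \<le> i then 0 else 1 :: nat)
          else (if Suc j \<le> i then 0 else 1) \<le> (if j \<le> i then 0 else 1 :: nat)"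
        using \<open>U (Suc i)\<close> by (cases "j = i") auto
    qed
    ultimately show False
      using fence_monotone_order by fastforce
  qed
  ultimately show "(i, Suc i) \<in> fence_order n U \<longleftrightarrow> U (Suc i)"
    "(Suc i, i) \<in> fence_order n U \<longleftrightarrow> \<not> U (Suc i)"
    using * ** by blast+
qed

lemma fence_monotone_iff:
  "fence_monotone n U f \<longleftrightarrow> (\<forall>x<n. \<forall>y<n. (x, y) \<in> fence_order n U \<longrightarrow> f x \<le> f y)"
proof
  assume mono: "\<forall>x<n. \<forall>y<n. (x, y) \<in> fence_order n U \<longrightarrow> f x \<le> f y"
  show "fence_monotone n U f"
    unfolding fence_monotone_def
  proof (intro allI impI)
    fix i assume "Suc i < n"
    then show "if U (Suc i) then f i \<le> f (Suc i) else f (Suc i) \<le> f i"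
      using mono fence_order_step[of i n U] by simp
  qed
qed (use fence_monotone_order in blast)

lemma Suc_in_fence_asc: "Suc i \<in> fence_asc n (fence_order n U) \<longleftrightarrow> Suc i < n \<and> U (Suc i)"
  by (auto simp: fence_asc_def poset_less_def fence_order_step)

lemma Suc_in_fence_desc: "Suc i \<in> fence_desc n (fence_order n U) \<longleftrightarrow> Suc i < n \<and> \<not> U (Suc i)"
  by (auto simp: fence_desc_def poset_less_def fence_order_step)

section \<open>The valid block partition\<close>

text \<open>
  A valid block partition can be read off from left to right. Let \<open>x\<close> be the root of the block that
  contains position \<open>i\<close>. If \<open>Suc i\<close> lies above \<open>i\<close>, then it can join that block only if its
  label is smaller than that of \<open>x\<close>, and validity lets it open a new block only if its label is
  larger; a step downwards is dual. So exactly one choice is possible.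
\<close>
fun current_root :: "(nat \<Rightarrow> bool) \<Rightarrow> (nat \<Rightarrow> nat) \<Rightarrow> nat \<Rightarrow> nat" where
  "current_root U \<sigma> 0 = 0"
| "current_root U \<sigma> (Suc i) =
     (if (if U (Suc i) then \<sigma> (current_root U \<sigma> i) < \<sigma> (Suc i) else \<sigma> (Suc i) < \<sigma> (current_root U \<sigma> i))
      then Suc i else current_root U \<sigma> i)"

lemma current_root_le: "current_root U \<sigma> i \<le> i"
  by (induction i) auto

lemma current_root_eq_between: "current_root U \<sigma> i \<le> k \<Longrightarrow> k \<le> i \<Longrightarrow> current_root U \<sigma> k = current_root U \<sigma> i"
  by (induction i) (auto simp: le_Suc_eq split: if_splits)

lemma current_root_idem: "current_root U \<sigma> (current_root U \<sigma> i) = current_root U \<sigma> i"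
  using current_root_eq_between current_root_le by blast

text \<open>
  The reason why the scan yields a valid partition: the labels of the roots change only at the start of
  a block, and there they move in the direction of the fence.
\<close>
lemma fence_monotone_root: "fence_monotone n U (\<lambda>i. \<sigma> (current_root U \<sigma> i))"
  by (auto simp: fence_monotone_def)

lemma new_blocks_root:
  assumes "i < n"
  shows "new_blocks (map U [Suc i..<n]) (\<sigma> (current_root U \<sigma> i)) (map \<sigma> [Suc i..<n])
      = card {j \<in> {Suc i..<n}. current_root U \<sigma> j = j}"
  using assms
proof (induction "n - i" arbitrary: i)
  case 0
  then show ?case by simp
next
  case (Suc d)
  show ?case
  proof (cases "Suc i < n")
    case True
    then have upt: "[Suc i..<n] = Suc i # [Suc (Suc i)..<n]"
      by (simp add: upt_conv_Cons)
    have range: "{Suc i..<n} = insert (Suc i) {Suc (Suc i)..<n}"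
      using True by auto
    have split: "{j \<in> insert m A. P j} = (if P m then insert m {j \<in> A. P j} else {j \<in> A. P j})"
      for m :: nat and A P
      by auto
    have card: "card {j \<in> {Suc i..<n}. current_root U \<sigma> j = j}
        = (if current_root U \<sigma> (Suc i) = Suc i then 1 else 0)
          + card {j \<in> {Suc (Suc i)..<n}. current_root U \<sigma> j = j}"
      unfolding range split by (simp del: current_root.simps)
    have "current_root U \<sigma> i \<noteq> Suc i"
      using current_root_le[of U \<sigma> i] by simp
    then show ?thesis
      using Suc.hyps(1)[of "Suc i"] Suc.hyps(2) True unfolding upt card by auto
  qed simp
qed

text \<open>
  The initial value \<open>0\<close> is a virtual root below all labels. As its position lies below position
  \<open>0\<close>, the leftmost position always opens a block.
\<close>
lemma new_blocks_card_roots: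
  assumes "U 0" "n > 0 \<Longrightarrow> 0 < \<sigma> 0"
  shows "new_blocks (map U [0..<n]) 0 (map \<sigma> [0..<n]) = card {j. j < n \<and> current_root U \<sigma> j = j}"
proof (cases "n = 0")
  case False
  then have upt: "[0..<n] = 0 # [Suc 0..<n]"
    by (simp add: upt_conv_Cons)
  have "new_blocks (map U [0..<n]) 0 (map \<sigma> [0..<n])
      = Suc (new_blocks (map U [Suc 0..<n]) (\<sigma> (current_root U \<sigma> 0)) (map \<sigma> [Suc 0..<n]))"
    using assms False unfolding upt by simp
  also have "\<dots> = Suc (card {j \<in> {Suc 0..<n}. current_root U \<sigma> j = j})"
    using False by (subst new_blocks_root) auto
  also have "\<dots> = card (insert 0 {j \<in> {Suc 0..<n}. current_root U \<sigma> j = j})"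
    by simp
  also have "insert 0 {j \<in> {Suc 0..<n}. current_root U \<sigma> j = j} = {j. j < n \<and> current_root U \<sigma> j = j}"
    using False by (auto simp: Suc_le_eq)
  finally show ?thesis .
qed simp

definition scan_block :: "nat \<Rightarrow> (nat \<Rightarrow> bool) \<Rightarrow> (nat \<Rightarrow> nat) \<Rightarrow> nat \<Rightarrow> nat set" where
  "scan_block n U \<sigma> x = {j. j < n \<and> current_root U \<sigma> j = x}"

definition scan_partition :: "nat \<Rightarrow> (nat \<Rightarrow> bool) \<Rightarrow> (nat \<Rightarrow> nat) \<Rightarrow> nat set set" where
  "scan_partition n U \<sigma> = scan_block n U \<sigma> ` {x. x < n \<and> current_root U \<sigma> x = x}"

lemma Min_scan_block:
  assumes "x < n" "current_root U \<sigma> x = x"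
  shows "Min (scan_block n U \<sigma> x) = x"
proof (rule Min_eqI)
  fix y assume "y \<in> scan_block n U \<sigma> x"
  then show "x \<le> y"
    using current_root_le[of U \<sigma> y] by (auto simp: scan_block_def)
qed (use assms in \<open>auto simp: scan_block_def\<close>)

lemma card_scan_partition:
  "card (scan_partition n U \<sigma>) = card {j. j < n \<and> current_root U \<sigma> j = j}"
  unfolding scan_partition_def
  by (rule card_image, rule inj_on_inverseI[where g = Min]) (simp add: Min_scan_block)

lemma scan_block_interval:
  assumes "x < n" "current_root U \<sigma> x = x"
  shows "\<exists>b. x \<le> b \<and> b < n \<and> scan_block n U \<sigma> x = {x..b}"
proof -
  let ?B = "scan_block n U \<sigma> x"
  have fin: "finite ?B" and x: "x \<in> ?B"
    using assms by (auto simp: scan_block_def)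
  have Max: "Max ?B \<in> ?B"
    using fin x by (intro Max_in) auto
  have "?B = {x..Max ?B}"
  proof (intro equalityI subsetI)
    fix y assume "y \<in> ?B"
    then show "y \<in> {x..Max ?B}"
      using fin current_root_le[of U \<sigma> y] by (auto simp: scan_block_def)
  next
    fix y assume "y \<in> {x..Max ?B}"
    then show "y \<in> ?B"
      using Max current_root_eq_between[of U \<sigma> "Max ?B" y] by (auto simp: scan_block_def)
  qed
  moreover have "x \<le> Max ?B" "Max ?B < n"
    using fin x Max by (auto simp: scan_block_def)
  ultimately show ?thesis by blast
qed

lemma scan_partition_valid:
  assumes "inj_on \<sigma> {..<n}"
  shows "valid_block_partition n (fence_order n U) \<sigma> (scan_partition n U \<sigma>)"
  unfolding valid_block_partition_def block_partition_def
proof (intro conjI ballI impI)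
  show "partition_on {..<n} (scan_partition n U \<sigma>)"
  proof (rule partition_onI)
    show "\<Union> (scan_partition n U \<sigma>) = {..<n}"
    proof (intro equalityI subsetI)
      fix j assume "j \<in> {..<n}"
      then have "j \<in> scan_block n U \<sigma> (current_root U \<sigma> j)" "current_root U \<sigma> j < n"
        using current_root_le[of U \<sigma> j] by (auto simp: scan_block_def)
      then show "j \<in> \<Union> (scan_partition n U \<sigma>)"
        unfolding scan_partition_def using current_root_idem by blast
    qed (auto simp: scan_partition_def scan_block_def)
  qed (auto simp: scan_partition_def scan_block_def disjnt_def)
next
  fix B assume "B \<in> scan_partition n U \<sigma>"
  then obtain x where x: "x < n" "current_root U \<sigma> x = x" and B: "B = scan_block n U \<sigma> x"
    by (auto simp: scan_partition_def)
  have "(y \<in> fence_asc n (fence_order n U) \<longrightarrow> \<sigma> y < \<sigma> x) \<and>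
      (y \<in> fence_desc n (fence_order n U) \<longrightarrow> \<sigma> y > \<sigma> x)" if y: "y \<in> B - {x}" for y
  proof -
    obtain y' where y': "y = Suc y'"
      using y B by (cases y) (auto simp: scan_block_def)
    have "y < n" "current_root U \<sigma> (Suc y') = x" "x \<noteq> Suc y'"
      using y y' by (auto simp: B scan_block_def)
    then have "\<not> (if U (Suc y') then \<sigma> x < \<sigma> (Suc y') else \<sigma> (Suc y') < \<sigma> x)"
      by (auto split: if_splits)
    moreover have "\<sigma> x \<noteq> \<sigma> (Suc y')"
      using assms x \<open>y < n\<close> \<open>x \<noteq> Suc y'\<close> y' by (auto dest: inj_onD)
    ultimately show ?thesis
      unfolding y' Suc_in_fence_asc Suc_in_fence_desc by auto
  qed
  then show "is_block n (fence_order n U) \<sigma> B"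
    using scan_block_interval[OF x] unfolding is_block_def B Min_scan_block[OF x] by blast
next
  fix B C assume "B \<in> scan_partition n U \<sigma>" "C \<in> scan_partition n U \<sigma>"
  then obtain x x' where x: "x < n" "current_root U \<sigma> x = x" and B: "B = scan_block n U \<sigma> x"
    and x': "x' < n" "current_root U \<sigma> x' = x'" and C: "C = scan_block n U \<sigma> x'"
    by (auto simp: scan_partition_def)
  assume BC: "B \<noteq> C \<and> block_less (fence_order n U) B C"
  then obtain y z where "y \<in> B" "z \<in> C" "(y, z) \<in> fence_order n U"
    by (auto simp: block_less_def poset_less_def)
  \<comment> \<open>Monotonicity of the root labels gives the weak inequality, injectivity the strict one.\<close>
  then have "\<sigma> x \<le> \<sigma> x'"
    using fence_monotone_order[OF fence_monotone_root] by (fastforce simp: B C scan_block_def)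
  moreover have "\<sigma> x \<noteq> \<sigma> x'"
    using BC assms x x' by (auto simp: B C dest: inj_onD)
  ultimately show "\<sigma> (Min B) < \<sigma> (Min C)"
    unfolding B C Min_scan_block[OF x] Min_scan_block[OF x'] by simp
qed

text \<open>
  By induction on the position, the minimum of the block containing it is the current root of the
  scan: joining the block of the predecessor is excluded by the block condition whenever the scan
  opens a new block, and opening a new block is excluded by validity in all other cases.
\<close>
lemma valid_block_partition_unique:
  assumes Q: "valid_block_partition n (fence_order n U) \<sigma> Q"
  shows "Q = scan_partition n U \<sigma>"
proof -
  have part: "partition_on {..<n} Q"
    and block: "\<And>B. B \<in> Q \<Longrightarrow> is_block n (fence_order n U) \<sigma> B"
    and valid: "\<And>B C. B \<in> Q \<Longrightarrow> C \<in> Q \<Longrightarrow> B \<noteq> C \<Longrightarrow> block_less (fence_order n U) B C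
        \<Longrightarrow> \<sigma> (Min B) < \<sigma> (Min C)"
    using Q by (auto simp: valid_block_partition_def block_partition_def)
  have interval: "B = {Min B..Max B}" "Min B \<in> B" if B: "B \<in> Q" for B
  proof -
    obtain a b where "a \<le> b" "B = {a..b}"
      using block[OF B] by (auto simp: is_block_def)
    moreover from this have "Min B = a" "Max B = b"
      by (auto intro!: Min_eqI Max_eqI)
    ultimately show "B = {Min B..Max B}" "Min B \<in> B"
      by auto
  qed
  have union: "\<Union> Q = {..<n}"
    using part by (simp add: partition_on_def)
  have cover: "\<exists>C\<in>Q. j \<in> C" if "j < n" for j
    using that union by (metis UnionE lessThan_iff)
  have below: "j < n" if "B \<in> Q" "j \<in> B" for B j
    using that union by blast
  have same: "B = C" if "B \<in> Q" "C \<in> Q" "j \<in> B" "j \<in> C" for B C j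
    using that part by (auto simp: partition_on_def disjoint_def)
  have Min: "Min B = current_root U \<sigma> j" if "B \<in> Q" "j \<in> B" for B j
    using that
  proof (induction j arbitrary: B)
    case 0
    then show ?case
      using interval[of B] by (metis atLeastAtMost_iff bot_nat_0.extremum_uniqueI current_root.simps(1))
  next
    case (Suc j)
    have "Suc j < n"
      using Suc.prems below by blast
    then obtain C where C: "C \<in> Q" "j \<in> C"
      using cover[of j] by auto
    have IH: "Min C = current_root U \<sigma> j"
      using Suc.IH[OF C] .
    show ?case
    proof (cases "Suc j \<in> C")
      case True
      then have "B = C"
        using same Suc.prems C by blast
      have "Min C \<noteq> Suc j"
        using interval(1)[OF C(1)] C(2) by (metis atLeastAtMost_iff not_less_eq_eq order_refl)
      then have "Suc j \<in> C - {Min C}"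
        using True by simp
      then have "(Suc j \<in> fence_asc n (fence_order n U) \<longrightarrow> \<sigma> (Suc j) < \<sigma> (Min C)) \<and>
          (Suc j \<in> fence_desc n (fence_order n U) \<longrightarrow> \<sigma> (Suc j) > \<sigma> (Min C))"
        using block[OF C(1)] unfolding is_block_def by blast
      then have "\<not> (if U (Suc j) then \<sigma> (Min C) < \<sigma> (Suc j) else \<sigma> (Suc j) < \<sigma> (Min C))"
        using \<open>Suc j < n\<close> unfolding Suc_in_fence_asc Suc_in_fence_desc by auto
      with IH \<open>B = C\<close> show ?thesis by (auto split: if_splits)
    next
      case False
      then have "B \<noteq> C"
        using Suc.prems by blast
      have "Min B = Suc j"
      proof (rule ccontr)
        assume "Min B \<noteq> Suc j"
        then have "j \<in> B"
          using interval(1)[OF Suc.prems(1)] Suc.prems(2)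
          by (metis Suc_leD atLeastAtMost_iff le_Suc_eq)
        then show False
          using same C Suc.prems(1) \<open>B \<noteq> C\<close> by blast
      qed
      have "\<sigma> (Min C) < \<sigma> (Min B)" if "U (Suc j)"
      proof -
        have "block_less (fence_order n U) C B"
          unfolding block_less_def poset_less_def
          using C(2) Suc.prems(2) that fence_order_step(1)[OF \<open>Suc j < n\<close>, of U] n_not_Suc_n by blast
        then show ?thesis
          using valid[OF C(1) Suc.prems(1)] \<open>B \<noteq> C\<close> by simp
      qed
      moreover have "\<sigma> (Min B) < \<sigma> (Min C)" if "\<not> U (Suc j)"
      proof -
        have "block_less (fence_order n U) B C"
          unfolding block_less_def poset_less_def
          using C(2) Suc.prems(2) that fence_order_step(2)[OF \<open>Suc j < n\<close>, of U] Suc_n_not_n by blast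
        then show ?thesis
          using valid[OF Suc.prems(1) C(1)] \<open>B \<noteq> C\<close> by simp
      qed
      ultimately show ?thesis
        unfolding IH \<open>Min B = Suc j\<close> by simp
    qed
  qed
  have B_eq: "B = scan_block n U \<sigma> (Min B)" if "B \<in> Q" for B
  proof (intro equalityI subsetI)
    fix j assume "j \<in> B"
    then show "j \<in> scan_block n U \<sigma> (Min B)"
      using Min[OF that] that below by (auto simp: scan_block_def)
  next
    fix j assume j: "j \<in> scan_block n U \<sigma> (Min B)"
    then obtain C where C: "C \<in> Q" "j \<in> C"
      using cover[of j] by (auto simp: scan_block_def)
    then have "Min C = Min B"
      using Min[OF C] j by (simp add: scan_block_def)
    then have "B = C"
      using same that C(1) interval(2) by metis
    with C show "j \<in> B" by simp
  qed
  show ?thesis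
  proof (intro equalityI subsetI)
    fix B assume "B \<in> Q"
    moreover have "Min B < n"
      using interval(2) below \<open>B \<in> Q\<close> by blast
    moreover have "current_root U \<sigma> (Min B) = Min B"
      using Min[OF \<open>B \<in> Q\<close> interval(2)[OF \<open>B \<in> Q\<close>]] by simp
    ultimately show "B \<in> scan_partition n U \<sigma>"
      using B_eq by (auto simp: scan_partition_def)
  next
    fix B assume "B \<in> scan_partition n U \<sigma>"
    then obtain x where x: "x < n" "current_root U \<sigma> x = x" "B = scan_block n U \<sigma> x"
      by (auto simp: scan_partition_def)
    then obtain C where C: "C \<in> Q" "x \<in> C"
      using cover[of x] by auto
    then show "B \<in> Q"
      using B_eq[OF C(1)] Min[OF C] x by simp
  qed
qed

lemma bl_eq_new_blocks:
  assumes "\<sigma> \<in> labelings n" "U 0"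
  shows "bl n (fence_order n U) \<sigma> = new_blocks (map U [0..<n]) 0 (map \<sigma> [0..<n])"
proof -
  have "inj_on \<sigma> {..<n}" and pos: "n > 0 \<Longrightarrow> 0 < \<sigma> 0"
    using assms by (auto simp: labelings_def bij_betw_def Suc_le_eq)
  then have "(THE Q. valid_block_partition n (fence_order n U) \<sigma> Q) = scan_partition n U \<sigma>"
    using scan_partition_valid valid_block_partition_unique by (intro the_equality)
  then show ?thesis
    unfolding bl_def by (simp add: card_scan_partition new_blocks_card_roots assms pos)
qed

section \<open>Assembling the order polynomial\<close>

lemma bij_betw_map_upt_PiE:
  "bij_betw (\<lambda>f. map f [0..<n]) {f \<in> {..<n} \<rightarrow>\<^sub>E A. P (map f [0..<n])}
     {xs. length xs = n \<and> set xs \<subseteq> A \<and> P xs}"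
proof (rule bij_betw_byWitness[where f' = "\<lambda>xs i. if i < n then xs ! i else undefined"])
  show "\<forall>f\<in>{f \<in> {..<n} \<rightarrow>\<^sub>E A. P (map f [0..<n])}.
      (\<lambda>i. if i < n then map f [0..<n] ! i else undefined) = f"
    by (auto simp: PiE_def extensional_def)
  have restore: "map (\<lambda>i. if i < n then xs ! i else undefined) [0..<n] = xs" if "length xs = n" for xs :: "'a list"
    using that by (intro nth_equalityI) auto
  show "\<forall>xs\<in>{xs. length xs = n \<and> set xs \<subseteq> A \<and> P xs}.
      map (\<lambda>i. if i < n then xs ! i else undefined) [0..<n] = xs"
    using restore by blast
  show "(\<lambda>f. map f [0..<n]) ` {f \<in> {..<n} \<rightarrow>\<^sub>E A. P (map f [0..<n])}
      \<subseteq> {xs. length xs = n \<and> set xs \<subseteq> A \<and> P xs}"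
    by (auto simp: PiE_iff)
  show "(\<lambda>xs i. if i < n then xs ! i else undefined) ` {xs. length xs = n \<and> set xs \<subseteq> A \<and> P xs}
      \<subseteq> {f \<in> {..<n} \<rightarrow>\<^sub>E A. P (map f [0..<n])}"
    using restore by (auto simp: PiE_iff extensional_def)
qed

lemma follows_upt:
  assumes "i < n"
  shows "follows (map U [Suc i..<n]) (f i) (map f [Suc i..<n]) \<longleftrightarrow>
    (\<forall>j. i \<le> j \<and> Suc j < n \<longrightarrow> (if U (Suc j) then f j \<le> f (Suc j) else f (Suc j) \<le> f j))"
  using assms
proof (induction "n - i" arbitrary: i)
  case 0
  then show ?case by simp
next
  case (Suc d)
  show ?case
  proof (cases "Suc i < n")
    case True
    then have upt: "[Suc i..<n] = Suc i # [Suc (Suc i)..<n]"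
      by (simp add: upt_conv_Cons)
    have split: "(\<forall>j. i \<le> j \<and> Suc j < n \<longrightarrow> R j) \<longleftrightarrow> R i \<and> (\<forall>j. Suc i \<le> j \<and> Suc j < n \<longrightarrow> R j)" for R
      using True by (metis Suc_leD le_antisym not_less_eq_eq order_refl)
    show ?thesis
      using Suc.hyps(1)[of "Suc i"] Suc.hyps(2) True
      unfolding upt split[of "\<lambda>j. if U (Suc j) then f j \<le> f (Suc j) else f (Suc j) \<le> f j"] by simp
  qed auto
qed

text \<open>
  A virtual leftmost element of value \<open>1\<close>, below position \<open>0\<close>, does not restrict the map.
\<close>
lemma card_order_preserving_maps_fence:
  assumes "U 0" "t > 0"
  shows "card (order_preserving_maps {..<n} (fence_order n U) t)
    = chain_extensions (map U [0..<n]) 0 (t - 1)"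
proof -
  have "fence_monotone n U f \<longleftrightarrow> follows (map U [0..<n]) 1 (map f [0..<n])"
    if f: "f \<in> {..<n} \<rightarrow>\<^sub>E {1..t}" for f
  proof (cases "n = 0")
    case False
    then have upt: "[0..<n] = 0 # [Suc 0..<n]"
      by (simp add: upt_conv_Cons)
    have "1 \<le> f 0"
      using False f by (auto simp: PiE_iff)
    then show ?thesis
      using False \<open>U 0\<close> follows_upt[of 0 n U f] by (simp add: upt fence_monotone_def)
  qed (simp add: fence_monotone_def)
  then have "order_preserving_maps {..<n} (fence_order n U) t
      = {f \<in> {..<n} \<rightarrow>\<^sub>E {1..t}. follows (map U [0..<n]) 1 (map f [0..<n])}"
    unfolding order_preserving_maps_def fence_monotone_iff by auto
  then have "card (order_preserving_maps {..<n} (fence_order n U) t)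
      = card {xs. length xs = n \<and> set xs \<subseteq> {1..t} \<and> follows (map U [0..<n]) 1 xs}"
    using bij_betw_same_card[OF bij_betw_map_upt_PiE] by simp
  also have "{xs. length xs = n \<and> set xs \<subseteq> {1..t} \<and> follows (map U [0..<n]) 1 xs}
      = {xs. set xs \<subseteq> {1..t} \<and> follows (map U [0..<n]) 1 xs}"
    using follows_imp_length by fastforce
  finally show ?thesis
    using card_follows[of 1 t "map U [0..<n]"] assms by simp
qed

lemma bij_betw_map_upt_labelings:
  "bij_betw (\<lambda>\<sigma>. map \<sigma> [0..<n]) (labelings n) (permutations_of_set {1..n})"
proof -
  have "labelings n = {\<sigma> \<in> {..<n} \<rightarrow>\<^sub>E {1..n}. map \<sigma> [0..<n] \<in> permutations_of_set {1..n}}"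
    by (auto simp: labelings_def bij_betw_def permutations_of_set_def distinct_map atLeast0LessThan)
  then have "bij_betw (\<lambda>\<sigma>. map \<sigma> [0..<n]) (labelings n)
      {xs. length xs = n \<and> set xs \<subseteq> {1..n} \<and> xs \<in> permutations_of_set {1..n}}"
    using bij_betw_map_upt_PiE[of n "{1..n}" "\<lambda>xs. xs \<in> permutations_of_set {1..n}"] by (simp only:)
  also have "{xs. length xs = n \<and> set xs \<subseteq> {1..n} \<and> xs \<in> permutations_of_set {1..n}}
      = permutations_of_set {1..n}"
    using length_finite_permutations_of_set[of _ "{1..n}"] by (auto simp: permutations_of_set_def)
  finally show ?thesis .
qed

lemma sum_power_bl:
  assumes "U 0"
  shows "(\<Sum>\<sigma>\<in>labelings n. t ^ bl n (fence_order n U) \<sigma>) = block_weight t (map U [0..<n]) 0 n"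
proof -
  have "(\<Sum>\<sigma>\<in>labelings n. t ^ bl n (fence_order n U) \<sigma>)
      = (\<Sum>\<sigma>\<in>labelings n. t ^ new_blocks (map U [0..<n]) 0 (map \<sigma> [0..<n]))"
    using assms by (simp add: bl_eq_new_blocks)
  also have "\<dots> = (\<Sum>xs\<in>permutations_of_set {1..n}. t ^ new_blocks (map U [0..<n]) 0 xs)"
    by (rule sum.reindex_bij_betw[OF bij_betw_map_upt_labelings])
  also have "\<dots> = block_weight t (map U [0..<n]) (card {s \<in> {1..n}. s < 0}) (card {s \<in> {1..n}. 0 < s})"
    by (rule sum_new_blocks) auto
  also have "{s \<in> {1..n}. 0 < s} = {1..n}"
    by auto
  finally show ?thesis by simp
qed

text \<open>
  Polynomials that agree at all positive integers are equal.
\<close>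
lemma order_polynomial_eqI:
  assumes "\<And>t. t > 0 \<Longrightarrow> poly p (of_nat t) = of_nat (card (order_preserving_maps A r t))"
  shows "order_polynomial A r = p"
  unfolding order_polynomial_def
proof (rule the_equality)
  fix q :: "rat poly"
  assume q: "\<forall>t. t > 0 \<longrightarrow> poly q (of_nat t) = of_nat (card (order_preserving_maps A r t))"
  show "q = p"
  proof (rule ccontr)
    assume "q \<noteq> p"
    then have "finite {x. poly (q - p) x = 0}"
      by (intro poly_roots_finite) simp
    moreover have "of_nat ` {0<..} \<subseteq> {x. poly (q - p) x = 0}"
      using q assms by auto
    ultimately have "finite (of_nat ` {0<..} :: rat set)"
      by (rule finite_subset[rotated])
    then show False
      by (simp add: finite_image_iff inj_on_def infinite_Ioi)
  qed
qed (use assms in simp)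

text \<open>
  A step upwards at position \<open>0\<close> encodes the virtual element below it, in accordance with the
  convention that the leftmost element belongs to the ascents.
\<close>
lemma fence_poset_normal_form:
  assumes "fence_poset n r"
  obtains U where "r = fence_order n U" "U 0"
proof -
  obtain U where "r = fence_order n U"
    using assms by (auto simp: fence_poset_def fence_order_def)
  moreover have "fence_order n U = fence_order n (U(0 := True))"
    by (simp add: fence_order_def fence_covers_Suc)
  ultimately show ?thesis
    using that[of "U(0 := True)"] by simp
qed

theorem theorem3p8:
  fixes n :: nat and r :: "nat rel"
  assumes "fence_poset n r"
  shows "order_polynomial {..<n} r =
    smult (1 / fact n) (\<Sum>\<sigma>\<in>labelings n. monom 1 (bl n r \<sigma>))"
proof -
  obtain U where r: "r = fence_order n U" and "U 0"
    using fence_poset_normal_form[OF assms] .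
  show ?thesis
  proof (rule order_polynomial_eqI)
    fix t :: nat assume "t > 0"
    have "(\<Sum>\<sigma>\<in>labelings n. t ^ bl n r \<sigma>) = fact n * card (order_preserving_maps {..<n} r t)"
      unfolding r sum_power_bl[of U, OF \<open>U 0\<close>] card_order_preserving_maps_fence[of U, OF \<open>U 0\<close> \<open>t > 0\<close>]
      using block_weight_eq_chain_extensions[of "t - 1" "map U [0..<n]"] \<open>t > 0\<close> by simp
    then have "(\<Sum>\<sigma>\<in>labelings n. of_nat t ^ bl n r \<sigma>)
        = (fact n * of_nat (card (order_preserving_maps {..<n} r t)) :: rat)"
      by (metis (mono_tags, lifting) of_nat_sum of_nat_power of_nat_mult of_nat_fact sum.cong)
    then show "poly (smult (1 / fact n) (\<Sum>\<sigma>\<in>labelings n. monom 1 (bl n r \<sigma>))) (of_nat t)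
        = (of_nat (card (order_preserving_maps {..<n} r t)) :: rat)"
      by (simp add: poly_sum poly_monom)
  qed
qed

end
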